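(* Let $(X,\rho)$ be a topologically complete metric space and let $A\subseteq X$ be a Suslin set. Then the following statements are equivalent: (i) $A$ is not $\sigma$-lower porous. (ii) There exist a nonempty closed set $F\subseteq A$ (closed in $X$) and a set $D\subseteq F$ dense in $F$ such that $F$ is lower porous (in $X$) at no point of $D$.
   Context: A metric space is topologically complete if its topology is induced by some complete metric. A Suslin set is a set obtained by the Suslin operation from closed sets. Let $(X,\rho)$ be a metric space; $B(x,r)$ denotes the open ball with centre $x$ and radius $r$. For $M\subseteq X$, $x\in X$, $R>0$ put $$\gamma(x,R,M)=\sup\{r>0:\ \text{for some } z\in X,\ B(z,r)\subseteq B(x,R)\setminus M\}$$ (with $\sup\emptyset=0$), and $\underline{p}(M,x)=\liminf_{R\to0_+}\frac{2\gamma(x,R,M)}{R}$. The set $M$ is lower porous at $x$ if $\underline{p}(M,x)>0$; $M$ is lower porous (in $X$) if it is lower porous at each of its points; $M$ is $\sigma$-lower porous (in $X$) if it is a countable union of lower porous sets. *)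

theory Defs
  imports "HOL-Analysis.Analysis"
begin

text \<open>The space is the whole type \<open>'a\<close> of class \<open>metric_space\<close>.\<close>

definition suslin_set :: "'a::topological_space set \<Rightarrow> bool" where
  "suslin_set A \<longleftrightarrow>
     (\<exists>C :: nat list \<Rightarrow> 'a set. (\<forall>s. closed (C s)) \<and>
        A = (\<Union>\<sigma> :: nat \<Rightarrow> nat. \<Inter>n\<in>{1..}. C (map \<sigma> [0..<n])))"

text \<open>
  The supremum can be infinite (for instance if \<open>M\<close> is empty and \<open>ball x R\<close> is the whole
  space), so it is taken in the extended reals; inserting \<open>0\<close> only affects the empty set,
  whose supremum would otherwise be \<open>-\<infinity>\<close>.
\<close>

definition porosity_radius :: "'a::metric_space \<Rightarrow> real \<Rightarrow> 'a set \<Rightarrow> ereal" where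
  "porosity_radius x R M =
     Sup (insert 0 {ereal r | r. r > 0 \<and> (\<exists>z. ball z r \<subseteq> ball x R - M)})"

definition lower_porosity :: "'a::metric_space set \<Rightarrow> 'a \<Rightarrow> ereal" where
  "lower_porosity M x = Liminf (at_right 0) (\<lambda>R::real. 2 * porosity_radius x R M / ereal R)"

definition lower_porous_at :: "'a::metric_space set \<Rightarrow> 'a \<Rightarrow> bool" where
  "lower_porous_at M x \<longleftrightarrow> lower_porosity M x > 0"

definition lower_porous :: "'a::metric_space set \<Rightarrow> bool" where
  "lower_porous M \<longleftrightarrow> (\<forall>x\<in>M. lower_porous_at M x)"

definition sigma_lower_porous :: "'a::metric_space set \<Rightarrow> bool" where
  "sigma_lower_porous A \<longleftrightarrow>
     (\<exists>\<M>. countable \<M> \<and> (\<forall>M\<in>\<M>. lower_porous M) \<and> A = \<Union>\<M>)"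

end

theory Submission
  imports Defs
begin

text \<open>
  Lower porosity at a point depends only on the closure of the set near that point, so if a
  closed set with a dense set of non-porous points were \<open>\<sigma>\<close>-lower porous, Baire's theorem would
  make some uniformly porous piece dense in a relatively open part, a contradiction.

  Conversely, let \<open>A s\<close> be the part of \<open>A\<close> coded by sequences extending \<open>s\<close>. Removing from \<open>A\<close>
  one \<open>\<sigma>\<close>-lower porous set \<open>N\<close> yields sets \<open>G s = A s - N\<close> which are lower porous at none of
  their points: locally \<open>\<sigma>\<close>-lower porous sets are \<open>\<sigma>\<close>-lower porous, and near each point where
  \<open>A s\<close> is not locally \<open>\<sigma>\<close>-lower porous, removing \<open>N\<close> does not change the closure.
  Starting with a point of \<open>G []\<close>, attach to each point \<open>x\<close> with code \<open>\<sigma>\<close> a sequence of finer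
  and finer nets, at scales witnessing non-porosity, in the sets \<open>G (\<sigma> 0, \<dots>, \<sigma> (k - 1))\<close>; give
  the net points codes with the same first \<open>k\<close> entries and iterate in tiny separated balls.
  A limit of the resulting tree is either one of its points or the limit of an infinite branch;
  in the latter case the codes converge and show that the limit lies in \<open>A\<close>.
\<close>

section \<open>Lower porosity\<close>

text \<open>For \<open>c \<ge> 0\<close> neither the inserted \<open>0\<close> nor the restriction
  \<open>r > 0\<close> affects a strict lower bound, so the extended reals can be left
  behind.\<close>

lemma porosity_radius_less_iff:
  assumes "0 \<le> c"
  shows "ereal c < porosity_radius x R M \<longleftrightarrow> (\<exists>z r. c < r \<and> ball z r \<subseteq> ball x R - M)"
    (is "_ \<longleftrightarrow> ?rhs")
proof -
  let ?S = "{ereal r | r. r > 0 \<and> (\<exists>z. ball z r \<subseteq> ball x R - M)}"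
  have "ereal c < Sup (insert 0 ?S) \<longleftrightarrow> ?rhs"
  proof
    assume "ereal c < Sup (insert 0 ?S)"
    then obtain t where t: "t \<in> insert 0 ?S" "ereal c < t"
      unfolding less_Sup_iff by blast
    have "t \<noteq> 0" using assms t(2) by auto
    then obtain r z where "t = ereal r" "ball z r \<subseteq> ball x R - M" using t(1) by blast
    moreover have "c < r" using t(2) \<open>t = ereal r\<close> by simp
    ultimately show ?rhs by blast
  next
    assume ?rhs
    then obtain z r where r: "c < r" "ball z r \<subseteq> ball x R - M" by blast
    have "ereal r \<in> insert 0 ?S" using r assms by (intro insertI2 CollectI exI[of _ r]) auto
    moreover have "ereal c < ereal r" using r(1) by simp
    ultimately show "ereal c < Sup (insert 0 ?S)"
      unfolding less_Sup_iff by blast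
  qed
  then show ?thesis unfolding porosity_radius_def .
qed

text \<open>The working form of porosity: the liminf and the factor 2 are absorbed into one constant
  \<open>c\<close> valid at all small scales.\<close>

lemma lower_porous_at_iff:
  "lower_porous_at M x \<longleftrightarrow>
    (\<exists>c>0. \<exists>d>0. \<forall>R. 0 < R \<longrightarrow> R < d \<longrightarrow> (\<exists>z r. c * R < r \<and> ball z r \<subseteq> ball x R - M))"
proof -
  have quot: "ereal c < 2 * porosity_radius x R M / ereal R \<longleftrightarrow>
      (\<exists>z r. c / 2 * R < r \<and> ball z r \<subseteq> ball x R - M)" if "c > 0" "R > 0" for c R :: real
  proof -
    have "ereal c < 2 * porosity_radius x R M / ereal R \<longleftrightarrow>
        ereal (R * c) < 2 * porosity_radius x R M"
      using that by (subst ereal_less_divide_pos) auto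
    also have "\<dots> \<longleftrightarrow> ereal (c / 2 * R) < porosity_radius x R M"
      by (cases "porosity_radius x R M") (auto simp: field_simps)
    finally show ?thesis using that by (simp add: porosity_radius_less_iff)
  qed
  have ev: "eventually P (at_right (0::real)) \<longleftrightarrow> (\<exists>d>0. \<forall>R. 0 < R \<longrightarrow> R < d \<longrightarrow> P R)" for P
    by (simp add: eventually_at_right_field)
  show ?thesis
  proof
    assume "lower_porous_at M x"
    then obtain c where c: "0 < ereal c" "ereal c < lower_porosity M x"
      unfolding lower_porous_at_def using ereal_dense2 by blast
    then have "eventually (\<lambda>R. ereal c < 2 * porosity_radius x R M / ereal R) (at_right 0)"
      unfolding lower_porosity_def by (intro less_LiminfD)
    then obtain d where "d > 0"
        "\<forall>R. 0 < R \<longrightarrow> R < d \<longrightarrow> ereal c < 2 * porosity_radius x R M / ereal R"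
      unfolding ev by blast
    then show "\<exists>c>0. \<exists>d>0. \<forall>R. 0 < R \<longrightarrow> R < d \<longrightarrow> (\<exists>z r. c * R < r \<and> ball z r \<subseteq> ball x R - M)"
      using c quot by (intro exI[of _ "c / 2"]) auto
  next
    assume "\<exists>c>0. \<exists>d>0. \<forall>R. 0 < R \<longrightarrow> R < d \<longrightarrow> (\<exists>z r. c * R < r \<and> ball z r \<subseteq> ball x R - M)"
    then obtain c d where cd: "c > 0" "d > 0"
      "\<And>R. 0 < R \<Longrightarrow> R < d \<Longrightarrow> \<exists>z r. c * R < r \<and> ball z r \<subseteq> ball x R - M" by blast
    have "ereal (2 * c) < 2 * porosity_radius x R M / ereal R" if "0 < R" "R < d" for R
      using quot[of "2 * c" R] cd that by simp
    then have "eventually (\<lambda>R. ereal (2 * c) \<le> 2 * porosity_radius x R M / ereal R) (at_right 0)"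
      unfolding ev using cd(2) by (intro exI[of _ d]) (auto intro: less_imp_le)
    then have "ereal (2 * c) \<le> lower_porosity M x"
      unfolding lower_porosity_def by (rule Liminf_bounded)
    then show "lower_porous_at M x"
      unfolding lower_porous_at_def using cd(1) by (auto intro: less_le_trans[of 0 "ereal (2 * c)"])
  qed
qed

text \<open>An open ball missing \<open>M\<close> also misses \<open>closure M\<close>, so for
  \<open>R < e\<close> every hole of \<open>M\<close> in \<open>ball x R\<close> is a hole of
  \<open>N\<close>.\<close>

lemma lower_porous_at_local_mono:
  assumes "lower_porous_at M x" "e > 0" "N \<inter> ball x e \<subseteq> closure M"
  shows "lower_porous_at N x"
proof -
  obtain c d where cd: "c > 0" "d > 0"
    "\<And>R. 0 < R \<Longrightarrow> R < d \<Longrightarrow> \<exists>z r. c * R < r \<and> ball z r \<subseteq> ball x R - M"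
    using assms(1) unfolding lower_porous_at_iff by blast
  have "\<exists>z r. c * R < r \<and> ball z r \<subseteq> ball x R - N" if R: "0 < R" "R < min d e" for R
  proof -
    obtain z r where zr: "c * R < r" "ball z r \<subseteq> ball x R - M" using cd(3)[of R] R by auto
    then have "ball z r \<inter> closure M = {}"
      by (subst open_Int_closure_eq_empty) auto
    moreover have "ball x R \<subseteq> ball x e" using R by auto
    ultimately have "ball z r \<subseteq> ball x R - N" using zr(2) assms(3) by blast
    then show ?thesis using zr(1) by blast
  qed
  then show ?thesis
    unfolding lower_porous_at_iff using cd(1,2) assms(2)
    by (intro exI[of _ c] conjI exI[of _ "min d e"]) auto
qed

lemma lower_porous_at_closure_mono:
  assumes "lower_porous_at M x" "N \<subseteq> closure M"
  shows "lower_porous_at N x"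
  by (rule lower_porous_at_local_mono[of M x 1]) (use assms in auto)

lemma lower_porous_at_subset: "lower_porous_at M x \<Longrightarrow> N \<subseteq> M \<Longrightarrow> lower_porous_at N x"
  using lower_porous_at_closure_mono closure_subset by (metis subset_trans)

lemma lower_porous_subset: "lower_porous M \<Longrightarrow> N \<subseteq> M \<Longrightarrow> lower_porous N"
  unfolding lower_porous_def using lower_porous_at_subset by blast

section \<open>The sigma-ideal of sigma-lower porous sets\<close>

lemma sigma_lower_porous_subset:
  assumes "sigma_lower_porous A" "B \<subseteq> A"
  shows "sigma_lower_porous B"
proof -
  obtain \<M> where M: "countable \<M>" "\<forall>M\<in>\<M>. lower_porous M" "A = \<Union>\<M>"
    using assms(1) unfolding sigma_lower_porous_def by blast
  have "B = \<Union>((\<inter>) B ` \<M>)" using assms(2) M(3) by auto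
  then show ?thesis
    unfolding sigma_lower_porous_def using M(1,2)
    by (intro exI[of _ "(\<inter>) B ` \<M>"]) (auto intro: lower_porous_subset)
qed

lemma sigma_lower_porous_Union:
  assumes "countable I" "\<And>i. i \<in> I \<Longrightarrow> sigma_lower_porous (A i)"
  shows "sigma_lower_porous (\<Union>i\<in>I. A i)"
proof -
  obtain \<M> where M: "\<And>i. i \<in> I \<Longrightarrow> countable (\<M> i) \<and> (\<forall>M\<in>\<M> i. lower_porous M) \<and> A i = \<Union>(\<M> i)"
    using assms(2) unfolding sigma_lower_porous_def by metis
  then show ?thesis
    unfolding sigma_lower_porous_def using assms(1)
    by (intro exI[of _ "\<Union>i\<in>I. \<M> i"]) auto
qed

lemma sigma_lower_porous_Un:
  "sigma_lower_porous A \<Longrightarrow> sigma_lower_porous B \<Longrightarrow> sigma_lower_porous (A \<union> B)"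
  using sigma_lower_porous_Union[of "{A, B}" id] by auto

lemma lower_porous_imp_sigma: "lower_porous M \<Longrightarrow> sigma_lower_porous M"
  unfolding sigma_lower_porous_def by (intro exI[of _ "{M}"]) auto

lemma sigma_lower_porous_sequence:
  assumes "sigma_lower_porous A"
  obtains M :: "nat \<Rightarrow> 'a::metric_space set"
    where "\<And>n. lower_porous (M n)" "A = (\<Union>n. M n)"
proof -
  obtain \<M> where M: "countable \<M>" "\<forall>M\<in>\<M>. lower_porous M" "A = \<Union>\<M>"
    using assms unfolding sigma_lower_porous_def by blast
  \<comment> \<open>Adding the empty set, vacuously lower porous, makes the family nonempty and
    hence the range of a sequence.\<close>
  define f where "f = from_nat_into (insert {} \<M>)"
  have f: "range f = insert {} \<M>"
    unfolding f_def using M(1) by (intro range_from_nat_into) auto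
  show thesis
  proof
    fix n
    have "f n \<in> insert {} \<M>" using f by blast
    then show "lower_porous (f n)" using M(2) by (auto simp: lower_porous_def[of "{}"])
  next
    show "A = (\<Union>n. f n)" using M(3) f by simp
  qed
qed

section \<open>Localization\<close>

text \<open>
  The points of \<open>E n x\<close> below are those for which \<open>x\<close> is the first centre whose ball contains
  them, and contains them with a margin of \<open>1 / (n + 1)\<close>; hence the sets \<open>E n x\<close> for different \<open>x\<close>
  have distance at least \<open>1 / (n + 1)\<close>.
\<close>

lemma sigma_lower_porous_local:
  fixes A :: "'a::metric_space set"
  assumes "\<And>x. x \<in> A \<Longrightarrow> \<exists>e>0. sigma_lower_porous (A \<inter> ball x e)"
  shows "sigma_lower_porous A"
proof -
  obtain e where e: "\<And>x. x \<in> A \<Longrightarrow> e x > 0 \<and> sigma_lower_porous (A \<inter> ball x (e x))"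
    using assms by metis
  have "\<exists>M :: nat \<Rightarrow> 'a set. (\<forall>n. lower_porous (M n)) \<and> A \<inter> ball x (e x) = (\<Union>n. M n)"
    if "x \<in> A" for x
    using e[OF that] by (metis sigma_lower_porous_sequence)
  then obtain M :: "'a \<Rightarrow> nat \<Rightarrow> 'a set"
    where M: "\<And>x n. x \<in> A \<Longrightarrow> lower_porous (M x n)"
      and MU: "\<And>x. x \<in> A \<Longrightarrow> A \<inter> ball x (e x) = (\<Union>n. M x n)"
    by metis
  \<comment> \<open>The space need not be separable, so uncountably many balls may be involved. A
    well-order of the centres gives each point a first ball, as in Stone's proof of
    paracompactness.\<close>
  obtain r :: "'a rel" where r: "well_order_on UNIV r" using well_order_on by blast
  define less where "less x y \<longleftrightarrow> (x, y) \<in> r - Id" for x y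
  have "{(x, y). less x y} = r - Id" unfolding less_def by blast
  then have wf: "wf {(x, y). less x y}"
    using r unfolding well_order_on_def by metis
  have total: "less x y \<or> less y x" if "x \<noteq> y" for x y
    using r that unfolding well_order_on_def linear_order_on_def total_on_def less_def by auto
  define E where "E n x = {y \<in> A. ball y (1 / Suc n) \<subseteq> ball x (e x) \<and>
      (\<forall>x'\<in>A. less x' x \<longrightarrow> y \<notin> ball x' (e x'))}" for n :: nat and x
  \<comment> \<open>Pieces of all centres are glued and only two integers remain as index, which
    makes the family countable; the gaps between the sets \<open>E n x\<close> keep each glued set
    lower porous.\<close>
  define N where "N n m = (\<Union>x\<in>A. M x m \<inter> E n x)" for n m
  have sep: "dist y y' \<ge> 1 / Suc n"
    if "y \<in> E n x" "y' \<in> E n x'" "x \<in> A" "less x x'" for n x x' y y'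
  proof (rule ccontr)
    assume "\<not> dist y y' \<ge> 1 / Suc n"
    then have "y' \<in> ball y (1 / Suc n)" by simp
    then have "y' \<in> ball x (e x)" using that(1) unfolding E_def by blast
    then show False using that unfolding E_def by auto
  qed
  have "lower_porous (N n m)" for n m
    unfolding lower_porous_def
  proof
    fix y assume "y \<in> N n m"
    then obtain x where x: "x \<in> A" "y \<in> M x m" "y \<in> E n x" unfolding N_def by blast
    have "N n m \<inter> ball y (1 / Suc n) \<subseteq> M x m"
    proof
      fix y' assume y': "y' \<in> N n m \<inter> ball y (1 / Suc n)"
      then obtain x' where x': "x' \<in> A" "y' \<in> M x' m" "y' \<in> E n x'" unfolding N_def by blast
      have "x' = x"
        using total[of x' x] sep[OF x'(3) x(3) x'(1)] sep[OF x(3) x'(3) x(1)] y'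
        by (metis IntD2 dist_commute mem_ball not_less)
      then show "y' \<in> M x m" using x'(2) by simp
    qed
    then have "N n m \<inter> ball y (1 / Suc n) \<subseteq> closure (M x m)"
      using closure_subset by (rule subset_trans)
    moreover have "lower_porous_at (M x m) y" using M x unfolding lower_porous_def by blast
    moreover have "1 / real (Suc n) > 0" by simp
    ultimately show "lower_porous_at (N n m) y" using lower_porous_at_local_mono by blast
  qed
  then have "sigma_lower_porous (\<Union>(n, m)\<in>UNIV. N n m)"
    by (intro sigma_lower_porous_Union) (auto intro: lower_porous_imp_sigma)
  moreover have "A \<subseteq> (\<Union>(n, m)\<in>UNIV. N n m)"
  proof
    fix y assume y: "y \<in> A"
    then have "y \<in> {x \<in> A. y \<in> ball x (e x)}" using e by simp
    from wfE_min[OF wf this] obtain x where "x \<in> {x \<in> A. y \<in> ball x (e x)}"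
      and "\<And>x'. (x', x) \<in> {(x, y). less x y} \<Longrightarrow> x' \<notin> {x \<in> A. y \<in> ball x (e x)}" by blast
    then have x: "x \<in> A" "y \<in> ball x (e x)"
      and least: "\<And>x'. less x' x \<Longrightarrow> x' \<in> A \<Longrightarrow> y \<notin> ball x' (e x')" by blast+
    obtain d where d: "d > 0" "ball y d \<subseteq> ball x (e x)"
      using x(2) open_ball open_contains_ball by blast
    obtain n where "1 / real (Suc n) < d"
      using d(1) by (metis nat_approx_posE)
    then have "ball y (1 / Suc n) \<subseteq> ball x (e x)"
      using d(2) by (meson less_imp_le subset_ball subset_trans)
    then have "y \<in> E n x" unfolding E_def using y least by blast
    moreover obtain m where "y \<in> M x m" using MU[OF x(1)] x y by blast
    ultimately show "y \<in> (\<Union>(n, m)\<in>UNIV. N n m)" unfolding N_def using x(1) by blast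
  qed
  ultimately show ?thesis by (rule sigma_lower_porous_subset)
qed

section \<open>The nonporous kernel of a set\<close>

definition nonsigma_points :: "'a::metric_space set \<Rightarrow> 'a set" where
  "nonsigma_points A = {x \<in> A. \<forall>e>0. \<not> sigma_lower_porous (A \<inter> ball x e)}"

text \<open>Porosity is tested against \<open>nonsigma_points A\<close> because this set stays
  inside \<open>closure (A - N)\<close> for every sigma-lower porous \<open>N\<close>.\<close>

definition nonporous_kernel :: "'a::metric_space set \<Rightarrow> 'a set" where
  "nonporous_kernel A = {x \<in> nonsigma_points A. \<not> lower_porous_at (nonsigma_points A) x}"

text \<open>Two pieces are removed: one is locally sigma-lower porous, the other consists of points
  at which the larger set \<open>nonsigma_points A\<close> is lower porous.\<close>

lemma sigma_lower_porous_diff_kernel: "sigma_lower_porous (A - nonporous_kernel A)"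
proof -
  have "sigma_lower_porous (A - nonsigma_points A)"
  proof (rule sigma_lower_porous_local)
    fix x assume "x \<in> A - nonsigma_points A"
    then obtain e where e: "e > 0" "sigma_lower_porous (A \<inter> ball x e)"
      unfolding nonsigma_points_def by blast
    have "sigma_lower_porous ((A - nonsigma_points A) \<inter> ball x e)"
      by (rule sigma_lower_porous_subset[OF e(2)]) blast
    with e(1) show "\<exists>e>0. sigma_lower_porous ((A - nonsigma_points A) \<inter> ball x e)" by blast
  qed
  moreover have "sigma_lower_porous (nonsigma_points A - nonporous_kernel A)"
  proof (rule lower_porous_imp_sigma, unfold lower_porous_def, rule ballI)
    fix x assume "x \<in> nonsigma_points A - nonporous_kernel A"
    then have "lower_porous_at (nonsigma_points A) x" unfolding nonporous_kernel_def by blast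
    then show "lower_porous_at (nonsigma_points A - nonporous_kernel A) x"
      by (rule lower_porous_at_subset) blast
  qed
  ultimately have "sigma_lower_porous
      ((A - nonsigma_points A) \<union> (nonsigma_points A - nonporous_kernel A))"
    by (rule sigma_lower_porous_Un)
  then show ?thesis by (rule sigma_lower_porous_subset) blast
qed

text \<open>Around a point of \<open>nonsigma_points A\<close> the set \<open>N\<close> never covers
  \<open>A\<close>, so \<open>A - N\<close> accumulates there and its porosity would pass to
  \<open>nonsigma_points A\<close>.\<close>

lemma nonporous_kernel_not_lower_porous_at:
  assumes "x \<in> nonporous_kernel A" "sigma_lower_porous N"
  shows "\<not> lower_porous_at (A - N) x"
proof
  assume "lower_porous_at (A - N) x"
  moreover have "nonsigma_points A \<subseteq> closure (A - N)"
  proof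
    fix y assume y: "y \<in> nonsigma_points A"
    show "y \<in> closure (A - N)"
      unfolding closure_approachable
    proof (intro allI impI)
      fix e :: real assume "e > 0"
      then have "\<not> sigma_lower_porous (A \<inter> ball y e)" using y unfolding nonsigma_points_def by blast
      then have "\<not> A \<inter> ball y e \<subseteq> N" using assms(2) sigma_lower_porous_subset by blast
      then obtain z where "z \<in> A - N" "z \<in> ball y e" by blast
      then show "\<exists>z\<in>A - N. dist z y < e" by (metis dist_commute mem_ball)
    qed
  qed
  ultimately have "lower_porous_at (nonsigma_points A) x" by (rule lower_porous_at_closure_mono)
  then show False using assms(1) unfolding nonporous_kernel_def by blast
qed

section \<open>The tree construction\<close>

text \<open>Zorn's lemma: a point at distance at least \<open>e\<close> from a maximal separated set
  could be added to it.\<close>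

lemma maximal_separated_subset:
  fixes S :: "'a::metric_space set"
  assumes "e > 0"
  obtains Y where "Y \<subseteq> S" "\<And>y y'. y \<in> Y \<Longrightarrow> y' \<in> Y \<Longrightarrow> y \<noteq> y' \<Longrightarrow> e \<le> dist y y'"
    "\<And>x. x \<in> S \<Longrightarrow> \<exists>y\<in>Y. dist x y < e"
proof -
  define \<A> where "\<A> = {Y. Y \<subseteq> S \<and> (\<forall>y\<in>Y. \<forall>y'\<in>Y. y \<noteq> y' \<longrightarrow> e \<le> dist y y')}"
  have "\<exists>Y\<in>\<A>. \<forall>X\<in>\<A>. Y \<subseteq> X \<longrightarrow> X = Y"
  proof (rule subset_Zorn')
    fix \<C> assume "subset.chain \<A> \<C>"
    then have C: "\<C> \<subseteq> \<A>" "\<And>X Y. X \<in> \<C> \<Longrightarrow> Y \<in> \<C> \<Longrightarrow> X \<subseteq> Y \<or> Y \<subseteq> X"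
      by (auto simp: subset_chain_def)
    have "e \<le> dist y y'" if yy: "y \<in> \<Union>\<C>" "y' \<in> \<Union>\<C>" "y \<noteq> y'" for y y'
    proof -
      obtain X where "X \<in> \<C>" "y \<in> X" "y' \<in> X" using C(2) yy(1,2) by blast
      then show ?thesis using C(1) yy(3) unfolding \<A>_def by blast
    qed
    then show "\<Union>\<C> \<in> \<A>" using C(1) unfolding \<A>_def by blast
  qed
  then obtain Y where Y: "Y \<in> \<A>" "\<And>X. X \<in> \<A> \<Longrightarrow> Y \<subseteq> X \<Longrightarrow> X = Y" by blast
  show thesis
  proof
    show "Y \<subseteq> S" "\<And>y y'. y \<in> Y \<Longrightarrow> y' \<in> Y \<Longrightarrow> y \<noteq> y' \<Longrightarrow> e \<le> dist y y'"
      using Y(1) unfolding \<A>_def by auto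
    fix x assume x: "x \<in> S"
    show "\<exists>y\<in>Y. dist x y < e"
    proof (rule ccontr)
      assume far: "\<not> (\<exists>y\<in>Y. dist x y < e)"
      then have "insert x Y \<in> \<A>"
        using Y(1) x unfolding \<A>_def by (auto simp: not_less dist_commute)
      then have "x \<in> Y" using Y(2) by blast
      then show False using far assms by auto
    qed
  qed
qed

text \<open>Points of the union within \<open>e / 2\<close> of \<open>p\<close> all carry the same
  index, so \<open>p\<close> is approximated inside one \<open>S i\<close> even when
  \<open>I\<close> is infinite.\<close>

lemma closure_separated_Union:
  fixes S :: "'i \<Rightarrow> 'a::metric_space set"
  assumes "e > 0"
    and "\<And>i j x y. i \<in> I \<Longrightarrow> j \<in> I \<Longrightarrow> x \<in> S i \<Longrightarrow> y \<in> S j \<Longrightarrow> dist x y < e \<Longrightarrow> i = j"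
    and "p \<in> closure (\<Union>i\<in>I. S i)"
  obtains i where "i \<in> I" "p \<in> closure (S i)"
proof -
  have app: "\<exists>i\<in>I. \<exists>q\<in>S i. dist q p < d" if "d > 0" for d
    using assms(3) that unfolding closure_approachable by auto
  obtain i q where i: "i \<in> I" "q \<in> S i" "dist q p < e / 2"
    using app[of "e / 2"] assms(1) by auto
  have "\<exists>q'\<in>S i. dist q' p < d" if "d > 0" for d
  proof -
    have "min d (e / 2) > 0" using assms(1) that by simp
    then obtain j q' where j: "j \<in> I" "q' \<in> S j" "dist q' p < min d (e / 2)"
      using app by blast
    have "dist q q' < e"
      using dist_triangle2[of q q' p] i(3) j(3) by auto
    then have "i = j" using assms(2) i j by blast
    then show ?thesis using j by auto
  qed
  then show thesis using that[of i] i(1) unfolding closure_approachable by blast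
qed

section \<open>Trees of nets in a scheme of non-porous sets\<close>

abbreviation initial :: "(nat \<Rightarrow> nat) \<Rightarrow> nat \<Rightarrow> nat list" where
  "initial \<sigma> n \<equiv> map \<sigma> [0..<n]"

lemma initial_eq_iff: "initial \<sigma> n = initial \<tau> n \<longleftrightarrow> (\<forall>i<n. \<sigma> i = \<tau> i)"
  by auto

text \<open>Isolates what the tree needs from a Suslin scheme: a point of \<open>G s\<close> can be
  followed along one infinite code starting with \<open>s\<close>. Closed sets enter only
  afterwards.\<close>

locale nonporous_scheme =
  fixes G :: "nat list \<Rightarrow> 'a::metric_space set"
  assumes code_exists:
      "x \<in> G s \<Longrightarrow> \<exists>\<sigma>. initial \<sigma> (length s) = s \<and> (\<forall>n. x \<in> G (initial \<sigma> n))"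
    and not_lower_porous_at: "x \<in> G s \<Longrightarrow> \<not> lower_porous_at (G s) x"
begin

text \<open>The index \<open>k\<close> sets the precision relative to \<open>R\<close>. The bound
  \<open>\<rho> / 2\<close> leaves room for the balls of the children, and \<open>1 / Suc k\<close>
  makes successive nets shrink to \<open>x\<close>.\<close>

definition is_net :: "'a \<Rightarrow> nat list \<Rightarrow> nat \<Rightarrow> real \<Rightarrow> real \<times> 'a set \<Rightarrow> bool" where
  "is_net x s k \<rho> = (\<lambda>(R, Y). 0 < R \<and> R \<le> \<rho> / 2 \<and> R < 1 / Suc k \<and> Y \<subseteq> G s \<inter> ball x R \<and>
     (\<forall>y\<in>Y. \<forall>y'\<in>Y. y \<noteq> y' \<longrightarrow> R / Suc k \<le> dist y y') \<and>
     (\<forall>z r. 3 * R / Suc k < r \<longrightarrow> ball z r \<subseteq> ball x R \<longrightarrow> Y \<inter> ball z r \<noteq> {}))"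

lemma net_exists:
  assumes "x \<in> G s" "\<rho> > 0"
  shows "\<exists>N. is_net x s k \<rho> N"
proof -
  define \<epsilon> where "\<epsilon> = 1 / real (Suc k)"
  have eps: "\<epsilon> > 0" unfolding \<epsilon>_def by simp
  \<comment> \<open>Non-porosity is applied with constant \<open>\<epsilon>\<close>; the threshold
    \<open>min (\<rho> / 2) \<epsilon>\<close> supplies the bounds on \<open>R\<close> that a net
    requires.\<close>
  have "\<not> (\<forall>R. 0 < R \<longrightarrow> R < min (\<rho> / 2) \<epsilon> \<longrightarrow> (\<exists>z r. \<epsilon> * R < r \<and> ball z r \<subseteq> ball x R - G s))"
    using not_lower_porous_at[OF assms(1)] assms(2) eps unfolding lower_porous_at_iff
    by (metis half_gt_zero min_less_iff_conj)
  then obtain R where R: "0 < R" "R < \<rho> / 2" "R < \<epsilon>"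
    and hit: "\<And>z r. \<epsilon> * R < r \<Longrightarrow> \<not> ball z r \<subseteq> ball x R - G s" by auto
  have eR: "\<epsilon> * R > 0" using eps R by simp
  obtain Y where Y: "Y \<subseteq> G s \<inter> ball x R"
    "\<And>y y'. y \<in> Y \<Longrightarrow> y' \<in> Y \<Longrightarrow> y \<noteq> y' \<Longrightarrow> \<epsilon> * R \<le> dist y y'"
    "\<And>u. u \<in> G s \<inter> ball x R \<Longrightarrow> \<exists>y\<in>Y. dist u y < \<epsilon> * R"
    using maximal_separated_subset[OF eR] by blast
  have "Y \<inter> ball z r \<noteq> {}" if "3 * (\<epsilon> * R) < r" "ball z r \<subseteq> ball x R" for z r
  proof -
    \<comment> \<open>The smaller ball already meets \<open>G s\<close>; the remaining
      \<open>\<epsilon> * R\<close> pays for moving from the point found to the net.\<close>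
    have "ball z (2 * (\<epsilon> * R)) \<subseteq> ball x R" using that eR by (auto simp: subset_iff)
    moreover have "\<not> ball z (2 * (\<epsilon> * R)) \<subseteq> ball x R - G s" by (rule hit) (use eR in linarith)
    ultimately obtain u where u: "u \<in> G s \<inter> ball x R" "u \<in> ball z (2 * (\<epsilon> * R))" by blast
    obtain y where "y \<in> Y" "dist u y < \<epsilon> * R" using Y(3)[OF u(1)] by blast
    moreover have "dist z y \<le> dist z u + dist u y" by (rule dist_triangle)
    ultimately have "y \<in> Y \<inter> ball z r" using u(2) that(1) by auto
    then show ?thesis by blast
  qed
  then have "is_net x s k \<rho> (R, Y)"
    unfolding is_net_def using R Y(1,2) by (auto simp: \<epsilon>_def field_simps)
  then show ?thesis ..
qed

definition code :: "'a \<Rightarrow> nat list \<Rightarrow> nat \<Rightarrow> nat" where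
  "code x s = (SOME \<sigma>. initial \<sigma> (length s) = s \<and> (\<forall>n. x \<in> G (initial \<sigma> n)))"

lemma code:
  assumes "x \<in> G s"
  shows "initial (code x s) (length s) = s" "x \<in> G (initial (code x s) n)"
  using someI_ex[OF code_exists[OF assms]] unfolding code_def by blast+

text \<open>
  A node \<open>(x, \<sigma>, m, \<rho>)\<close> consists of a point, its code, the first level at which nets are attached
  to it, and the radius of a ball around \<open>x\<close> to which all its descendants are confined.
\<close>

type_synonym 'b node = "'b \<times> (nat \<Rightarrow> nat) \<times> nat \<times> real"

fun valid :: "'a node \<Rightarrow> bool" where
  "valid (x, \<sigma>, m, \<rho>) \<longleftrightarrow> \<rho> > 0 \<and> (\<forall>n. x \<in> G (initial \<sigma> n))"

fun net :: "'a node \<Rightarrow> nat \<Rightarrow> real \<times> 'a set" where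
  "net (x, \<sigma>, m, \<rho>) k = (SOME N. is_net x (initial \<sigma> k) k \<rho> N)"

text \<open>The radius is a quarter of the separation of the net, so subtrees of distinct net points
  keep half of it as distance. The level \<open>Suc k\<close> makes levels grow strictly along
  branches, which lets codes converge.\<close>

fun child :: "'a node \<Rightarrow> nat \<Rightarrow> 'a \<Rightarrow> 'a node" where
  "child (x, \<sigma>, m, \<rho>) k y =
     (y, code y (initial \<sigma> k), Suc k, fst (net (x, \<sigma>, m, \<rho>) k) / (4 * Suc k))"

inductive parent :: "'a node \<Rightarrow> 'a node \<Rightarrow> bool" where
  "m \<le> k \<Longrightarrow> y \<in> snd (net (x, \<sigma>, m, \<rho>) k) \<Longrightarrow> parent (x, \<sigma>, m, \<rho>) (child (x, \<sigma>, m, \<rho>) k y)"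

definition points :: "'a node \<Rightarrow> 'a set" where
  "points N = {fst N' | N'. parent\<^sup>*\<^sup>* N N'}"

lemma net:
  assumes "valid (x, \<sigma>, m, \<rho>)"
  obtains R Y where "net (x, \<sigma>, m, \<rho>) k = (R, Y)" "is_net x (initial \<sigma> k) k \<rho> (R, Y)"
proof -
  have "\<exists>N. is_net x (initial \<sigma> k) k \<rho> N" using assms by (intro net_exists) auto
  then have "is_net x (initial \<sigma> k) k \<rho> (net (x, \<sigma>, m, \<rho>) k)" by (simp add: someI_ex)
  then show thesis using that by (cases "net (x, \<sigma>, m, \<rho>) k") auto
qed

definition refines :: "'a node \<Rightarrow> 'a node \<Rightarrow> bool" where
  "refines = (\<lambda>(x, \<sigma>, m, \<rho>) (y, \<tau>, n, \<rho>').
     dist x y + \<rho>' \<le> \<rho> \<and> m \<le> n \<and> initial \<tau> m = initial \<sigma> m)"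

lemma parent_valid:
  assumes "parent N N'" "valid N"
  shows "valid N' \<and> refines N N' \<and> fst (snd (snd N)) < fst (snd (snd N'))"
  using assms
proof cases
  case (1 m k y x \<sigma> \<rho>)
  obtain R Y where RY: "net (x, \<sigma>, m, \<rho>) k = (R, Y)" "is_net x (initial \<sigma> k) k \<rho> (R, Y)"
    using net assms(2) 1(1) by metis
  have R: "0 < R" "R \<le> \<rho> / 2" and y: "y \<in> G (initial \<sigma> k)" "dist x y < R"
    using RY 1 unfolding is_net_def by auto
  have "R / (4 * Suc k) \<le> R" using R(1) by (simp add: field_simps)
  then have "dist x y + R / (4 * Suc k) \<le> \<rho>" using R y by linarith
  moreover have "initial (code y (initial \<sigma> k)) k = initial \<sigma> k" using code(1)[OF y(1)] by simp
  then have "initial (code y (initial \<sigma> k)) m = initial \<sigma> m"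
    using 1 unfolding initial_eq_iff by auto
  ultimately show ?thesis
    using 1 RY(1) R(1) code(2)[OF y(1)] by (auto simp: refines_def)
qed

lemma refines_refl: "refines N N"
  by (cases N) (simp add: refines_def)

lemma refines_trans:
  assumes "refines N1 N2" "refines N2 N3"
  shows "refines N1 N3"
proof -
  obtain x1 s1 m1 r1 x2 s2 m2 r2 x3 s3 m3 r3
    where N: "N1 = (x1, s1, m1, r1)" "N2 = (x2, s2, m2, r2)" "N3 = (x3, s3, m3, r3)"
    by (cases N1, cases N2, cases N3) auto
  show ?thesis
    using assms dist_triangle[of x1 x3 x2] unfolding N refines_def prod.case initial_eq_iff
    by auto
qed

lemma descendant_valid:
  assumes "parent\<^sup>*\<^sup>* N N'" "valid N"
  shows "valid N' \<and> refines N N'"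
  using assms
  by (induction rule: rtranclp_induct) (auto intro: refines_refl dest: parent_valid refines_trans)

lemma points_subset:
  assumes "valid (x, \<sigma>, m, \<rho>)"
  shows "points (x, \<sigma>, m, \<rho>) \<subseteq> G (initial \<sigma> m) \<inter> cball x \<rho>"
proof
  fix q assume "q \<in> points (x, \<sigma>, m, \<rho>)"
  then obtain \<tau> n \<rho>' where d: "parent\<^sup>*\<^sup>* (x, \<sigma>, m, \<rho>) (q, \<tau>, n, \<rho>')"
    unfolding points_def by auto
  have *: "valid (q, \<tau>, n, \<rho>')" "refines (x, \<sigma>, m, \<rho>) (q, \<tau>, n, \<rho>')"
    using descendant_valid[OF d assms] by auto
  then have "q \<in> G (initial \<tau> m)" "initial \<tau> m = initial \<sigma> m" "dist x q \<le> \<rho>"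
    by (auto simp: refines_def)
  then show "q \<in> G (initial \<sigma> m) \<inter> cball x \<rho>" by auto
qed

lemma points_cases:
  assumes "q \<in> points N"
  obtains "q = fst N" | N' where "parent N N'" "q \<in> points N'"
proof -
  obtain N' where N': "parent\<^sup>*\<^sup>* N N'" "q = fst N'" using assms unfolding points_def by blast
  from N'(1) show thesis
  proof (cases rule: converse_rtranclpE)
    case base
    then show thesis using that(1) N'(2) by simp
  next
    case (step N'')
    then show thesis using that(2) N'(2) unfolding points_def by blast
  qed
qed

text \<open>Nets of high level lie close to the node, so away from it only finitely many levels
  matter; within one level the subtrees are uniformly separated.\<close>

lemma closure_points_cases:
  assumes "valid N" "p \<in> closure (points N)" "p \<noteq> fst N"
  obtains N' where "parent N N'" "p \<in> closure (points N')"
proof -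
  obtain x \<sigma> m \<rho> where N: "N = (x, \<sigma>, m, \<rho>)" by (cases N)
  have "\<exists>R Y. net N k = (R, Y) \<and> is_net x (initial \<sigma> k) k \<rho> (R, Y)" for k
    using net assms(1) unfolding N by metis
  then obtain R Y where RY: "\<And>k. net N k = (R k, Y k)"
    and nets: "\<And>k. is_net x (initial \<sigma> k) k \<rho> (R k, Y k)" by metis
  have R: "0 < R k" "R k < 1 / Suc k" for k using nets[of k] by (auto simp: is_net_def)
  have Y: "dist x y < R k" if "y \<in> Y k" for k y
    using nets[of k] that by (auto simp: is_net_def)
  have sep: "R k / Suc k \<le> dist y y'" if "y \<in> Y k" "y' \<in> Y k" "y \<noteq> y'" for k y y'
    using nets[of k] that by (auto simp: is_net_def)
  have par: "parent N (child N k y)" if "m \<le> k" "y \<in> Y k" for k y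
    using parent.intros[of m k y x \<sigma> \<rho>] RY[of k] that unfolding N by simp
  have near: "dist y q \<le> R k / (4 * Suc k)"
    if "m \<le> k" "y \<in> Y k" "q \<in> points (child N k y)" for k y q
  proof -
    have "valid (child N k y)" using parent_valid[OF par[OF that(1,2)] assms(1)] by simp
    from points_subset[OF this[unfolded N child.simps]] that(3) RY[of k] show ?thesis
      unfolding N by auto
  qed
  define P where "P k = (\<Union>y\<in>Y k. points (child N k y))" for k
  define d where "d = dist p x"
  have d: "d > 0" using assms(3) unfolding d_def N by simp
  \<comment> \<open>Subtrees of level \<open>k\<close> lie within \<open>2 / Suc k\<close> of
    \<open>x\<close>, so a point of one that is closer to \<open>p\<close> than \<open>d / 2\<close>
    forces \<open>Suc k < 4 / d\<close>.\<close>
  obtain K :: nat where K: "4 / d < K" using reals_Archimedean2 by blast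
  have "p \<in> closure (\<Union>k\<in>{m..<K}. P k)"
    unfolding closure_approachable
  proof (intro allI impI)
    fix e :: real assume "e > 0"
    then have "min e (d / 2) > 0" using d by simp
    then obtain q where q: "q \<in> points N" "dist q p < min e (d / 2)"
      using assms(2) unfolding closure_approachable by blast
    from q(1) show "\<exists>q\<in>\<Union>k\<in>{m..<K}. P k. dist q p < e"
    proof (cases rule: points_cases)
      case 1
      then show ?thesis using q(2) d unfolding N d_def by (auto simp: dist_commute)
    next
      case (2 N')
      then obtain k y where k: "m \<le> k" "y \<in> Y k" "N' = child N k y"
        using RY unfolding N by (auto elim!: parent.cases)
      have "R k / (4 * Suc k) \<le> R k" using R(1)[of k] by (simp add: field_simps)
      moreover have "dist y q \<le> R k / (4 * Suc k)" using near k 2 by blast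
      moreover have "dist x q \<le> dist x y + dist y q" by (rule dist_triangle)
      ultimately have "dist x q < 2 * (1 / Suc k)" using Y[OF k(2)] R(2)[of k] by linarith
      moreover have "d \<le> dist q p + dist x q"
        unfolding d_def using dist_triangle[of p x q] by (simp add: dist_commute)
      ultimately have "d / 2 < 2 * (1 / Suc k)" using q(2) by auto
      then have "Suc k < 4 / d" using d by (simp add: field_simps)
      then have "k < K" using K by linarith
      then have "q \<in> (\<Union>k\<in>{m..<K}. P k)" unfolding P_def using k 2 by auto
      then show ?thesis using q(2) by auto
    qed
  qed
  moreover have "closure (\<Union>k\<in>{m..<K}. P k) \<subseteq> (\<Union>k\<in>{m..<K}. closure (P k))"
  proof (rule closure_minimal)
    show "(\<Union>k\<in>{m..<K}. P k) \<subseteq> (\<Union>k\<in>{m..<K}. closure (P k))"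
      by (intro UN_mono order_refl closure_subset)
    show "closed (\<Union>k\<in>{m..<K}. closure (P k))" by (intro closed_UN) auto
  qed
  ultimately have "p \<in> (\<Union>k\<in>{m..<K}. closure (P k))" by blast
  then obtain k where k: "m \<le> k" "p \<in> closure (P k)" by auto
  \<comment> \<open>The error budget: two subtree radii plus a gap of half the separation add up to
    the whole separation.\<close>
  have quarters: "a / (4 * b) + a / (2 * b) + a / (4 * b) = a / b" for a b :: real
    by (cases "b = 0") (auto simp: field_simps)
  have "R k / (2 * Suc k) > 0" using R(1) by simp
  moreover have "y = y'"
    if "y \<in> Y k" "y' \<in> Y k" "q \<in> points (child N k y)" "q' \<in> points (child N k y')"
      "dist q q' < R k / (2 * Suc k)" for y y' q q'
  proof (rule ccontr)
    assume "y \<noteq> y'"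
    then have "R k / Suc k \<le> dist y y'" using sep that by blast
    also have "\<dots> \<le> dist y q + dist q q' + dist y' q'"
      by metric
    also have "\<dots> < R k / (4 * Suc k) + R k / (2 * Suc k) + R k / (4 * Suc k)"
      using near[OF k(1)] that by (meson add_le_less_mono add_less_le_mono)
    also have "\<dots> = R k / Suc k"
      using quarters[of "R k" "real (Suc k)"] by simp
    finally show False by simp
  qed
  ultimately obtain y where "y \<in> Y k" "p \<in> closure (points (child N k y))"
    using closure_separated_Union[of _ "Y k"] k(2) unfolding P_def by metis
  then show thesis using that par k(1) by blast
qed

text \<open>The node of \<open>x\<close> carries a net at every level from \<open>m\<close> on, and
  a net of high level meets any hole that is large relative to its scale.\<close>

lemma points_not_lower_porous_at:
  assumes "valid N" "x \<in> points N"
  shows "\<not> lower_porous_at (points N) x"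
proof
  assume "lower_porous_at (points N) x"
  then obtain c d where cd: "c > 0" "d > 0"
    "\<And>R. 0 < R \<Longrightarrow> R < d \<Longrightarrow> \<exists>z r. c * R < r \<and> ball z r \<subseteq> ball x R - points N"
    unfolding lower_porous_at_iff by blast
  obtain \<sigma> m \<rho> where N': "parent\<^sup>*\<^sup>* N (x, \<sigma>, m, \<rho>)"
    using assms(2) unfolding points_def by auto
  then have "valid (x, \<sigma>, m, \<rho>)" using descendant_valid assms(1) by blast
  \<comment> \<open>The bound \<open>d\<close> makes the scale of the net admissible;
    \<open>c / 3\<close> matches the 3 in \<open>is_net\<close>.\<close>
  obtain k0 where k0: "1 / real (Suc k0) < min d (c / 3)"
    using cd by (metis nat_approx_posE half_gt_zero divide_pos_pos min_less_iff_conj zero_less_numeral)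
  define k where "k = max m k0"
  have "1 / real (Suc k) \<le> 1 / real (Suc k0)" unfolding k_def by (simp add: field_simps)
  then have k: "m \<le> k" "1 / real (Suc k) < d" "3 / real (Suc k) < c"
    using k0 unfolding k_def by auto
  obtain R Y where RY: "net (x, \<sigma>, m, \<rho>) k = (R, Y)" "is_net x (initial \<sigma> k) k \<rho> (R, Y)"
    using net[OF \<open>valid (x, \<sigma>, m, \<rho>)\<close>] by blast
  have R: "0 < R" "R < d" using RY(2) k(2) unfolding is_net_def by auto
  have "Y \<subseteq> points N"
  proof
    fix y assume "y \<in> Y"
    then have "parent (x, \<sigma>, m, \<rho>) (child (x, \<sigma>, m, \<rho>) k y)"
      using RY(1) k(1) by (intro parent.intros) auto
    with N' have "parent\<^sup>*\<^sup>* N (child (x, \<sigma>, m, \<rho>) k y)" by simp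
    then show "y \<in> points N" unfolding points_def by force
  qed
  obtain z r where zr: "c * R < r" "ball z r \<subseteq> ball x R - points N"
    using cd(3)[OF R] by blast
  have "3 * R / Suc k < r"
    using mult_strict_right_mono[OF k(3) R(1)] zr(1) by simp
  moreover have "ball z r \<subseteq> ball x R" using zr(2) by blast
  ultimately have "Y \<inter> ball z r \<noteq> {}"
    using RY(2) unfolding is_net_def by blast
  with \<open>Y \<subseteq> points N\<close> zr(2) show False by blast
qed

text \<open>As \<open>p\<close> is never the point of a node, \<open>closure_points_cases\<close>
  can be repeated forever; the nodes so chosen have codes that stabilize entry by entry.\<close>

lemma closure_points_branch:
  assumes "valid N" "p \<in> closure (points N)" "p \<notin> points N"
  obtains \<tau> where "\<And>n. p \<in> closure (G (initial \<tau> n))"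
proof -
  define Q where "Q N' \<longleftrightarrow> parent\<^sup>*\<^sup>* N N' \<and> p \<in> closure (points N')" for N'
  have "\<exists>f. \<forall>n. Q (f n) \<and> parent (f n) (f (Suc n))"
  proof (rule dependent_nat_choice)
    show "\<exists>N'. Q N'" using assms(2) unfolding Q_def by blast
    fix N' :: "'a node" and n :: nat assume N': "Q N'"
    then have "valid N'" using assms(1) descendant_valid unfolding Q_def by blast
    moreover have "p \<noteq> fst N'" using N' assms(3) unfolding Q_def points_def by blast
    moreover have "p \<in> closure (points N')" using N' unfolding Q_def by blast
    ultimately obtain N'' where N'': "parent N' N''" "p \<in> closure (points N'')"
      using closure_points_cases by blast
    then have "Q N''"
      using N' unfolding Q_def by (blast intro: rtranclp.rtrancl_into_rtrancl)
    with N''(1) show "\<exists>N''. Q N'' \<and> parent N' N''" by blast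
  qed
  then obtain f where f: "\<And>n. Q (f n)" "\<And>n. parent (f n) (f (Suc n))" by blast
  define \<sigma> where "\<sigma> n = fst (snd (f n))" for n
  define m where "m n = fst (snd (snd (f n)))" for n
  have val: "valid (f n)" for n
    using f(1) assms(1) descendant_valid unfolding Q_def by blast
  have m_ge: "n \<le> m n" for n
  proof (induction n)
    case (Suc n)
    have "m n < m (Suc n)" using parent_valid[OF f(2) val] unfolding m_def by blast
    then show ?case using Suc by simp
  qed simp
  have ref: "refines (f i) (f (i + j))" for i j
  proof (induction j)
    case (Suc j)
    then show ?case using parent_valid[OF f(2) val, of "i + j"] refines_trans by auto
  qed (simp add: refines_refl)
  have agree: "\<sigma> j l = \<sigma> i l" if "i \<le> j" "l < m i" for i j l
  proof -
    have "refines (f i) (f j)" using ref[of i "j - i"] that(1) by simp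
    then have "initial (\<sigma> j) (m i) = initial (\<sigma> i) (m i)"
      unfolding \<sigma>_def m_def refines_def by (auto simp: case_prod_unfold)
    then show ?thesis using that(2) unfolding initial_eq_iff by blast
  qed
  \<comment> \<open>Node \<open>Suc n\<close> has level at least \<open>Suc n\<close>, so entry
    \<open>n\<close> of the code is frozen from that node on.\<close>
  define \<tau> where "\<tau> n = \<sigma> (Suc n) n" for n
  have "p \<in> closure (G (initial \<tau> n))" for n
  proof -
    have l: "\<tau> l = \<sigma> n l" if "l < n" for l
      using agree[of "Suc l" n l] that m_ge[of "Suc l"] unfolding \<tau>_def by auto
    have "points (f n) \<subseteq> G (initial (\<sigma> n) n)"
    proof
      fix q assume "q \<in> points (f n)"
      then obtain N' where N': "parent\<^sup>*\<^sup>* (f n) N'" "q = fst N'" unfolding points_def by blast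
      obtain \<upsilon> l \<rho> where q: "N' = (q, \<upsilon>, l, \<rho>)" using N'(2) by (cases N') auto
      obtain x \<rho>' where fn: "f n = (x, \<sigma> n, m n, \<rho>')"
        unfolding \<sigma>_def m_def by (cases "f n") auto
      have "valid N'" "refines (f n) N'" using descendant_valid[OF N'(1) val] by auto
      then have "q \<in> G (initial \<upsilon> n)" "initial \<upsilon> (m n) = initial (\<sigma> n) (m n)"
        unfolding q fn by (simp_all add: refines_def del: map_eq_conv)
      moreover from this(2) have "initial \<upsilon> n = initial (\<sigma> n) n"
        using m_ge[of n] unfolding initial_eq_iff by simp
      ultimately show "q \<in> G (initial (\<sigma> n) n)" by simp
    qed
    moreover have "initial \<tau> n = initial (\<sigma> n) n" using l unfolding initial_eq_iff by blast
    ultimately have "closure (points (f n)) \<subseteq> closure (G (initial \<tau> n))"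
      by (simp only: closure_mono)
    then show ?thesis using f(1)[of n] unfolding Q_def by blast
  qed
  then show thesis using that by blast
qed

end

section \<open>The characterization\<close>

lemma suslin_inscribe:
  fixes A :: "'a::metric_space set"
  assumes "suslin_set A" "\<not> sigma_lower_porous A"
  obtains D where "D \<noteq> {}" "closure D \<subseteq> A" "\<And>x. x \<in> D \<Longrightarrow> \<not> lower_porous_at (closure D) x"
proof -
  obtain C :: "nat list \<Rightarrow> 'a set" where C: "\<And>s. closed (C s)"
    "A = (\<Union>\<sigma>. \<Inter>n\<in>{1..}. C (initial \<sigma> n))"
    using assms(1) unfolding suslin_set_def by blast
  \<comment> \<open>The Suslin operation starts at \<open>n = 1\<close>, so \<open>C []\<close>
    imposes no condition and \<open>B [] = A\<close>.\<close>
  define B where "B s = {x. \<exists>\<sigma>. initial \<sigma> (length s) = s \<and> (\<forall>n\<ge>1. x \<in> C (initial \<sigma> n))}" for s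
  \<comment> \<open>There are only countably many lists. Removing the same \<open>N\<close> from
    every \<open>B s\<close> keeps a surviving point in all sets along its code.\<close>
  define N where "N = (\<Union>s. B s - nonporous_kernel (B s))"
  define G where "G s = B s - N" for s
  have N: "sigma_lower_porous N"
    unfolding N_def by (intro sigma_lower_porous_Union) (auto intro: sigma_lower_porous_diff_kernel)
  have BA: "B [] = A" unfolding B_def C(2) by auto
  have BC: "B s \<subseteq> C s" if "s \<noteq> []" for s
    using that unfolding B_def by (auto simp: Suc_le_eq)
  interpret nonporous_scheme G
  proof
    fix x s assume x: "x \<in> G s"
    then obtain \<sigma> where \<sigma>: "initial \<sigma> (length s) = s" "\<forall>n\<ge>1. x \<in> C (initial \<sigma> n)"
      unfolding G_def B_def by blast
    have "x \<in> G (initial \<sigma> n)" for n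
      using x \<sigma>(2) unfolding G_def B_def by auto
    with \<sigma>(1) show "\<exists>\<sigma>. initial \<sigma> (length s) = s \<and> (\<forall>n. x \<in> G (initial \<sigma> n))" by blast
    have "x \<in> nonporous_kernel (B s)" using x unfolding G_def N_def by blast
    then show "\<not> lower_porous_at (G s) x"
      unfolding G_def using N by (rule nonporous_kernel_not_lower_porous_at)
  qed
  have "\<not> A \<subseteq> N" using N assms(2) sigma_lower_porous_subset by blast
  then obtain x where x: "x \<in> G []" unfolding G_def BA by blast
  define T where "T = (x, code x [], 0::nat, 1::real)"
  have T: "valid T" unfolding T_def using code[OF x] by simp
  show thesis
  proof
    show "points T \<noteq> {}" unfolding points_def by blast
    show "closure (points T) \<subseteq> A"
    proof
      fix p assume p: "p \<in> closure (points T)"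
      show "p \<in> A"
      proof (cases "p \<in> points T")
        case True
        then show ?thesis using points_subset[OF T[unfolded T_def]] BA unfolding T_def G_def by auto
      next
        case False
        then obtain \<tau> where \<tau>: "\<And>n. p \<in> closure (G (initial \<tau> n))"
          using closure_points_branch T p by metis
        \<comment> \<open>Here closedness of the sets \<open>C s\<close> turns the limit of a branch
          into a point coded by \<open>\<tau>\<close>.\<close>
        have "p \<in> C (initial \<tau> n)" if "n \<ge> 1" for n
        proof -
          have "G (initial \<tau> n) \<subseteq> C (initial \<tau> n)" using BC[of "initial \<tau> n"] that unfolding G_def by auto
          then show ?thesis using \<tau> C(1) closure_minimal by blast
        qed
        then show ?thesis unfolding C(2) by blast
      qed
    qed
    fix y assume "y \<in> points T"
    then show "\<not> lower_porous_at (closure (points T)) y"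
      using points_not_lower_porous_at[OF T] lower_porous_at_subset closure_subset by metis
  qed
qed

text \<open>A hole at scale \<open>R\<close> around \<open>x\<close> comes from scale
  \<open>R / 2\<close> around some \<open>y\<close> in \<open>E\<close> near \<open>x\<close>. Since
  \<open>y\<close> depends on \<open>R\<close>, the constants must be uniform over
  \<open>E\<close>.\<close>

lemma lower_porous_at_closure_uniform:
  assumes "\<And>x R. x \<in> E \<Longrightarrow> 0 < R \<Longrightarrow> R < d \<Longrightarrow> \<exists>z r. c * R < r \<and> ball z r \<subseteq> ball x R - E"
    and "c > 0" "d > 0" "x \<in> closure E"
  shows "lower_porous_at E x"
proof -
  have "\<exists>z r. c / 2 * R < r \<and> ball z r \<subseteq> ball x R - E" if R: "0 < R" "R < d" for R
  proof -
    obtain y where y: "y \<in> E" "dist y x < R / 2"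
      using assms(4) R(1) unfolding closure_approachable by (meson half_gt_zero)
    obtain z r where zr: "c * (R / 2) < r" "ball z r \<subseteq> ball y (R / 2) - E"
      using assms(1)[OF y(1), of "R / 2"] R by auto
    have "ball y (R / 2) \<subseteq> ball x R"
    proof
      fix u assume "u \<in> ball y (R / 2)"
      then show "u \<in> ball x R"
        using y(2) dist_triangle[of x u y] by (auto simp: dist_commute)
    qed
    then show ?thesis using zr by (intro exI[of _ z] exI[of _ r]) auto
  qed
  then show ?thesis
    unfolding lower_porous_at_iff using assms(2,3)
    by (intro exI[of _ "c / 2"] conjI exI[of _ d]) auto
qed

text \<open>Baire's theorem in \<open>F\<close>: a piece with uniform porosity constants is dense in
  a relatively open part of \<open>F\<close>, which makes \<open>F\<close> lower porous at a point
  of \<open>D\<close>.\<close>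

lemma closed_not_sigma_lower_porous:
  fixes F :: "'a::metric_space set"
  assumes "completely_metrizable_space (euclidean :: 'a topology)"
    and "closed F" "F \<noteq> {}" "D \<subseteq> F" "F \<subseteq> closure D"
    and "\<And>x. x \<in> D \<Longrightarrow> \<not> lower_porous_at F x"
  shows "\<not> sigma_lower_porous F"
proof
  assume "sigma_lower_porous F"
  then obtain M :: "nat \<Rightarrow> 'a set" where M: "\<And>n. lower_porous (M n)" "F = (\<Union>n. M n)"
    by (rule sigma_lower_porous_sequence) blast
  \<comment> \<open>The single number \<open>1 / Suc k\<close> serves as both porosity constant and
    threshold, so countably many pieces suffice.\<close>
  define E where "E n k = {x \<in> M n. \<forall>R. 0 < R \<longrightarrow> R < 1 / Suc k \<longrightarrow>
      (\<exists>z r. 1 / Suc k * R < r \<and> ball z r \<subseteq> ball x R - M n)}" for n k :: nat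
  have E_lp: "lower_porous_at (E n k) x" if "x \<in> closure (E n k)" for n k x
  proof (rule lower_porous_at_closure_uniform[OF _ _ _ that])
    fix y R assume "y \<in> E n k" "0 < R" "R < 1 / real (Suc k)"
    then show "\<exists>z r. 1 / real (Suc k) * R < r \<and> ball z r \<subseteq> ball y R - E n k"
      unfolding E_def by blast
  qed auto
  have EM: "M n \<subseteq> (\<Union>k. E n k)" for n
  proof
    fix x assume x: "x \<in> M n"
    then obtain c d where cd: "c > 0" "d > 0"
      "\<And>R. 0 < R \<Longrightarrow> R < d \<Longrightarrow> \<exists>z r. c * R < r \<and> ball z r \<subseteq> ball x R - M n"
      using M(1) unfolding lower_porous_def lower_porous_at_iff by blast
    obtain k where k: "1 / real (Suc k) < min c d"
      using cd(1,2) by (metis nat_approx_posE min_less_iff_conj)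
    have "\<exists>z r. 1 / Suc k * R < r \<and> ball z r \<subseteq> ball x R - M n" if "0 < R" "R < 1 / Suc k" for R
    proof -
      have "R < d" using that k by linarith
      then obtain z r where zr: "c * R < r" "ball z r \<subseteq> ball x R - M n"
        using cd(3)[OF \<open>0 < R\<close>] by blast
      have "1 / Suc k * R \<le> c * R" using k that by (intro mult_right_mono) auto
      then have "1 / Suc k * R < r" using zr(1) by linarith
      then show ?thesis using zr(2) by blast
    qed
    then show "x \<in> (\<Union>k. E n k)" unfolding E_def using x by blast
  qed
  define X where "X = subtopology euclidean F"
  define \<G> where "\<G> = range (\<lambda>(n, k). F \<inter> closure (E n k))"
  have "completely_metrizable_space X"
    unfolding X_def using assms(1,2) by (simp add: completely_metrizable_space_closedin)
  moreover have "countable \<G>" unfolding \<G>_def by simp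
  moreover have "closedin X T" if "T \<in> \<G>" for T
    using that unfolding \<G>_def X_def by (auto simp: closedin_closed_Int)
  moreover have "X interior_of \<Union>\<G> \<noteq> {}"
  proof -
    have "F \<subseteq> \<Union>\<G>"
    proof
      fix x assume x: "x \<in> F"
      then obtain n k where "x \<in> E n k" using EM unfolding M(2) by blast
      then have "x \<in> F \<inter> closure (E n k)" using x closure_subset by blast
      then show "x \<in> \<Union>\<G>" unfolding \<G>_def by blast
    qed
    then have "\<Union>\<G> = topspace X" unfolding \<G>_def X_def by auto
    then have "X interior_of \<Union>\<G> = topspace X" by (simp only: interior_of_topspace)
    then show ?thesis using assms(3) by (simp add: X_def)
  qed
  ultimately obtain T where T: "T \<in> \<G>" "X interior_of T \<noteq> {}"
    using Baire_category_alt[of X \<G>] by blast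
  then obtain n k where "T = F \<inter> closure (E n k)" unfolding \<G>_def by auto
  moreover obtain x U where "x \<in> U" "openin X U" "U \<subseteq> T"
    using T(2) unfolding interior_of_def by auto
  moreover then obtain V where V: "open V" "U = F \<inter> V" unfolding X_def openin_open by auto
  ultimately have x: "x \<in> F" "x \<in> V" "F \<inter> V \<subseteq> closure (E n k)" by auto
  then obtain y where y: "y \<in> D" "y \<in> V"
    using assms(5) V(1) by (metis closure_iff_nhds_not_empty disjoint_iff order_refl subsetD)
  then obtain e where e: "e > 0" "ball y e \<subseteq> V" using V(1) open_contains_ball by blast
  have "y \<in> closure (E n k)" using y x(3) assms(4) by blast
  \<comment> \<open>Near \<open>y\<close> the set \<open>F\<close> lies in
    \<open>closure (E n k)\<close>, and porosity of \<open>E n k\<close> holds even at points of its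
    closure.\<close>
  then have "lower_porous_at F y"
    using E_lp e x(3) by (intro lower_porous_at_local_mono[of "E n k" y e F]) auto
  then show False using assms(6) y(1) by blast
qed

theorem proposition2p11:
  fixes A :: "'a::metric_space set"
  assumes "completely_metrizable_space (euclidean :: 'a topology)"
    and "suslin_set A"
  shows "\<not> sigma_lower_porous A \<longleftrightarrow>
    (\<exists>F D. closed F \<and> F \<noteq> {} \<and> F \<subseteq> A \<and> D \<subseteq> F \<and> F \<subseteq> closure D \<and>
       (\<forall>x\<in>D. \<not> lower_porous_at F x))"
proof
  assume "\<not> sigma_lower_porous A"
  then obtain D where "D \<noteq> {}" "closure D \<subseteq> A" "\<And>x. x \<in> D \<Longrightarrow> \<not> lower_porous_at (closure D) x"
    using suslin_inscribe[OF assms(2)] by blast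
  then show "\<exists>F D. closed F \<and> F \<noteq> {} \<and> F \<subseteq> A \<and> D \<subseteq> F \<and> F \<subseteq> closure D \<and>
      (\<forall>x\<in>D. \<not> lower_porous_at F x)"
    using closure_subset[of D] by (intro exI[of _ "closure D"] exI[of _ D]) auto
next
  assume "\<exists>F D. closed F \<and> F \<noteq> {} \<and> F \<subseteq> A \<and> D \<subseteq> F \<and> F \<subseteq> closure D \<and>
      (\<forall>x\<in>D. \<not> lower_porous_at F x)"
  then obtain F D where "F \<subseteq> A" and F: "closed F" "F \<noteq> {}" "D \<subseteq> F" "F \<subseteq> closure D"
    "\<And>x. x \<in> D \<Longrightarrow> \<not> lower_porous_at F x" by blast
  from closed_not_sigma_lower_porous[OF assms(1) F] \<open>F \<subseteq> A\<close> show "\<not> sigma_lower_porous A" using sigma_lower_porous_subset by blast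
qed

end
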